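(* No lattice tiling by balls can be disjoint: if $\mathcal{X}$ is an infinite-dimensional real normed space and $\mathcal{D}$ is a subgroup of $\mathcal{X}$ such that $\{d+B_{\mathcal{X}}\colon d\in\mathcal{D}\}$ is a tiling of $\mathcal{X}$ (with distinct $d$ giving tiles with disjoint interiors), then there are distinct $d,h\in\mathcal{D}$ such that $(d+B_{\mathcal{X}})\cap(h+B_{\mathcal{X}})\neq\emptyset$.
   Context: $B_{\mathcal{X}}$ is the closed unit ball of $\mathcal{X}$. A body in a normed space is a set that is the closure of its non-empty interior. A tiling of a normed space $\mathcal{X}$ is a family of bodies that covers $\mathcal{X}$ and whose members have mutually disjoint interiors. A lattice tiling by balls of $\mathcal{X}$ is a tiling of the form $\{d+B_{\mathcal{X}}\colon d\in\mathcal{D}\}$, where $\mathcal{D}$ is a (discrete) subgroup of $\mathcal{X}$. A tiling is disjoint if distinct tiles do not intersect. *)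

theory Defs
  imports "HOL-Analysis.Analysis"
begin

definition add_subgroup :: "'a::group_add set \<Rightarrow> bool" where
  "add_subgroup D \<longleftrightarrow> 0 \<in> D \<and> (\<forall>x\<in>D. \<forall>y\<in>D. x + y \<in> D) \<and> (\<forall>x\<in>D. - x \<in> D)"

definition body :: "'a::real_normed_vector set \<Rightarrow> bool" where
  "body S \<longleftrightarrow> interior S \<noteq> {} \<and> S = closure (interior S)"

text \<open>Tilings are indexed families: interiors are disjoint for distinct indices. Since the
  interior of a body is non-empty, a tile cannot be repeated under two indices.\<close>

definition tiling :: "'i set \<Rightarrow> ('i \<Rightarrow> 'a::real_normed_vector set) \<Rightarrow> bool" where
  "tiling I T \<longleftrightarrow>
     (\<forall>i\<in>I. body (T i)) \<and> (\<Union>i\<in>I. T i) = UNIV \<and> disjoint_family_on (\<lambda>i. interior (T i)) I"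

text \<open>Discreteness of \<open>D\<close> is not required separately: disjointness of the interiors of the tiles
  already forces distinct elements of \<open>D\<close> to be at distance at least 2.\<close>

definition lattice_tiling_by_balls :: "'a::real_normed_vector set \<Rightarrow> bool" where
  "lattice_tiling_by_balls D \<longleftrightarrow> add_subgroup D \<and> tiling D (\<lambda>d. (+) d ` cball 0 1)"

end

theory Submission
  imports Defs
begin

text \<open>Suppose the tiles are disjoint. For \<open>d \<in> D\<close>, the midpoint \<open>d/2\<close> lies in some tile with
  centre \<open>h\<close>, and by reflection also in the tile with centre \<open>d - h\<close>; hence \<open>h = d - h\<close>, that is,
  \<open>d/2 = h \<in> D\<close>. Thus \<open>D\<close> is closed under halving and contains nonzero vectors of arbitrarily
  small norm, whose tiles meet the tile centred at \<open>0\<close>.\<close>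

lemma mem_plus_image_cball_iff:
  fixes d x :: "'a::real_normed_vector"
  shows "x \<in> (+) d ` cball 0 1 \<longleftrightarrow> norm (x - d) \<le> 1"
  by (simp add: cball_translation [symmetric] dist_norm norm_minus_commute)

text \<open>The point reflection sending \<open>h\<close> to \<open>d - h\<close> preserves both
  \<open>D\<close> and the distance to its centre \<open>d/2\<close>. As \<open>d/2\<close> lies in
  only one tile, the centre of that tile is a fixed point, hence \<open>d/2\<close> itself.\<close>

lemma half_mem_if_disjoint_unit_balls:
  fixes D :: "'a::real_normed_vector set"
  assumes D: "add_subgroup D"
    and cover: "(\<Union>d\<in>D. (+) d ` cball 0 1) = UNIV"
    and disj: "disjoint_family_on (\<lambda>d. (+) d ` cball 0 1) D"
    and d: "d \<in> D"
  shows "(1/2) *\<^sub>R d \<in> D"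
proof -
  obtain h where h: "h \<in> D" "norm ((1/2) *\<^sub>R d - h) \<le> 1"
  proof -
    have "(1/2) *\<^sub>R d \<in> (\<Union>d\<in>D. (+) d ` cball 0 1)"
      unfolding cover by (rule UNIV_I)
    then show thesis
      using that unfolding UN_iff mem_plus_image_cball_iff by blast
  qed
  have "d + - h \<in> D"
    using D d h(1) unfolding add_subgroup_def by blast
  then have "d - h \<in> D"
    by simp
  moreover have "(1/2) *\<^sub>R d - (d - h) = - ((1/2) *\<^sub>R d - h)"
    using scaleR_half_double [of d] by (simp add: algebra_simps)
  then have "norm ((1/2) *\<^sub>R d - (d - h)) \<le> 1"
    using h(2) by (simp only: norm_minus_cancel)
  ultimately have "h = d - h"
    using disjoint_family_onD [OF disj h(1), of "d - h"] h(2)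
    unfolding disjoint_iff mem_plus_image_cball_iff by blast
  then have "d = h + h"
    by (simp add: algebra_simps)
  then show ?thesis
    using h(1) by simp
qed

theorem proposition3p12:
  fixes D :: "'a::real_normed_vector set"
  assumes infinite_dimensional: "\<not> (\<exists>B::'a set. finite B \<and> span B = UNIV)"
    and lattice: "lattice_tiling_by_balls D"
  shows "\<exists>d\<in>D. \<exists>h\<in>D. d \<noteq> h \<and> ((+) d ` cball 0 1) \<inter> ((+) h ` cball 0 1) \<noteq> {}"
proof (rule ccontr)
  assume "\<not> ?thesis"
  \<comment> \<open>Here the closed balls are disjoint, whereas \<open>tiling\<close> gives this for
    interiors.\<close>
  then have disj: "disjoint_family_on (\<lambda>d. (+) d ` cball 0 1) D"
    unfolding disjoint_family_on_def by blast
  have D: "add_subgroup D" and cover: "(\<Union>d\<in>D. (+) d ` cball 0 1) = UNIV"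
    using lattice unfolding lattice_tiling_by_balls_def tiling_def by blast+
  have "span {} \<noteq> (UNIV :: 'a set)"
    using infinite_dimensional by blast
  then obtain v :: 'a where "v \<noteq> 0"
    by auto
  \<comment> \<open>Norm 2 exceeds the radius 1, so a tile containing \<open>x\<close> cannot be
    centred at \<open>0\<close>.\<close>
  define x where "x = (2 / norm v) *\<^sub>R v"
  have "norm x = 2"
    using \<open>v \<noteq> 0\<close> by (simp add: x_def)
  obtain d where d: "d \<in> D" "norm (x - d) \<le> 1"
  proof -
    have "x \<in> (\<Union>d\<in>D. (+) d ` cball 0 1)"
      unfolding cover by (rule UNIV_I)
    then show thesis
      using that unfolding UN_iff mem_plus_image_cball_iff by blast
  qed
  then have "d \<noteq> 0"
    using \<open>norm x = 2\<close> by auto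
  have halves: "(1/2) ^ n *\<^sub>R d \<in> D" for n
  proof (induction n)
    case 0
    then show ?case using d by simp
  next
    case (Suc n)
    then show ?case
      using half_mem_if_disjoint_unit_balls [OF D cover disj Suc] by simp
  qed
  obtain n where "(1/2) ^ n < 1 / norm d"
    using real_arch_pow_inv [of "1 / norm d" "1/2"] \<open>d \<noteq> 0\<close> by auto
  then have "norm ((1/2) ^ n *\<^sub>R d) \<le> 1"
    using \<open>d \<noteq> 0\<close> by (simp add: field_simps)
  \<comment> \<open>The common point is the small vector itself, the centre of the second tile.
    Removing \<open>image_add_0\<close> keeps the first tile in the form that
    \<open>mem_plus_image_cball_iff\<close> matches.\<close>
  then have "(1/2) ^ n *\<^sub>R d \<in> (+) 0 ` cball 0 1 \<inter> (+) ((1/2) ^ n *\<^sub>R d) ` cball 0 1"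
    by (simp add: mem_plus_image_cball_iff del: image_add_0)
  moreover have "0 \<in> D" "(1/2) ^ n *\<^sub>R d \<noteq> 0"
    using D \<open>d \<noteq> 0\<close> by (auto simp: add_subgroup_def)
  ultimately show False
    using disj halves [of n] unfolding disjoint_family_on_def by (metis empty_iff)
qed

end
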